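(* Let $d\in\mathbb{N}$. If $t(d,n)$ is unbounded as a function of $n$, then in every digraph with minimum out-degree at least $d+1$, each pair of distinct vertices is separable by a friendly partition.
   Context: Digraphs are finite, without loops and without parallel arcs in the same direction. A friendly partition of a digraph $G=(V,E)$ is an unordered partition $\{V_1,V_2\}$ of $V$ into two nonempty sets such that every vertex has at least one out-neighbor in its own part; it separates vertices $u,v$ if they lie in different parts. $t(d,n)$ denotes the minimum, over all digraphs with $n$ vertices and minimum out-degree (at least) $d$, of the number of friendly partitions of the digraph. *)

theory Defs
  imports "Graph_Theory.Digraph" "HOL-Library.Disjoint_Sets"
begin

definition min_out_degree :: "('a, 'b) pre_digraph \<Rightarrow> nat" where
  "min_out_degree G = Min (out_degree G ` verts G)"

text \<open>Unordered partitions are sets of parts; \<^const>\<open>partition_on\<close> already forces the parts to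
  be nonempty.\<close>

definition friendly_partition :: "('a, 'b) pre_digraph \<Rightarrow> 'a set set \<Rightarrow> bool" where
  "friendly_partition G P \<longleftrightarrow>
     partition_on (verts G) P \<and> card P = 2 \<and> (\<forall>A\<in>P. \<forall>x\<in>A. \<exists>y\<in>A. x \<rightarrow>\<^bsub>G\<^esub> y)"

definition separates :: "'a set set \<Rightarrow> 'a \<Rightarrow> 'a \<Rightarrow> bool" where
  "separates P u v \<longleftrightarrow> (\<exists>A\<in>P. \<exists>B\<in>P. A \<noteq> B \<and> u \<in> A \<and> v \<in> B)"

text \<open>Every finite digraph without parallel arcs is isomorphic to one with vertices in
  \<^typ>\<open>nat\<close> and arcs in \<^typ>\<open>nat \<times> nat\<close>, so the minimum may be taken over those. It is taken over
  a nonempty set when \<open>d < n\<close>, and only then is the value meaningful: a nonempty loopless digraph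
  with minimum out-degree at least \<open>d\<close> has more than \<open>d\<close> vertices.\<close>

definition min_friendly_partitions :: "nat \<Rightarrow> nat \<Rightarrow> nat" where
  "min_friendly_partitions d n =
     (INF G \<in> {G :: (nat, nat \<times> nat) pre_digraph.
                 digraph G \<and> card (verts G) = n \<and> d \<le> min_out_degree G}.
        card {P. friendly_partition G P})"

end

theory Submission
  imports Defs
begin

text \<open>By contraposition. Suppose that \<open>G\<close> has minimum out-degree at least \<open>d + 1\<close> and that no
  friendly partition separates \<open>u\<close> from \<open>v\<close>. Delete all arcs into \<open>v\<close>, which costs every vertex at
  most one out-neighbour, and add arbitrarily many clones of \<open>v\<close> that have the same out-neighbours as
  \<open>v\<close> and no in-neighbours. If a friendly partition of the resulting digraph separated \<open>u\<close> from some
  clone, then merging the clones into \<open>v\<close> and placing \<open>v\<close> on the side of that clone would give a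
  friendly partition of \<open>G\<close> separating \<open>u\<close> from \<open>v\<close>. So all clones lie on the side of \<open>u\<close>, and the
  partition is determined by its other part, a subset of the vertices of \<open>G\<close>. The number of friendly
  partitions is therefore bounded independently of the number of clones.\<close>

lemma friendly_partition_iff:
  "friendly_partition G P \<longleftrightarrow>
     (\<exists>A B. P = {A, B} \<and> A \<noteq> {} \<and> B \<noteq> {} \<and> A \<inter> B = {} \<and> A \<union> B = verts G \<and>
        (\<forall>x\<in>A. \<exists>y\<in>A. x \<rightarrow>\<^bsub>G\<^esub> y) \<and> (\<forall>x\<in>B. \<exists>y\<in>B. x \<rightarrow>\<^bsub>G\<^esub> y))"
  (is "?L \<longleftrightarrow> ?R")
proof
  assume L: ?L
  then obtain A B where P: "P = {A, B}" "A \<noteq> B"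
    by (auto simp: friendly_partition_def card_2_iff)
  with L have "A \<noteq> {}" "B \<noteq> {}" "A \<inter> B = {}" "A \<union> B = verts G"
    unfolding friendly_partition_def partition_on_def disjoint_def by simp_all blast+
  moreover have "\<forall>x\<in>A. \<exists>y\<in>A. x \<rightarrow>\<^bsub>G\<^esub> y" "\<forall>x\<in>B. \<exists>y\<in>B. x \<rightarrow>\<^bsub>G\<^esub> y"
    using L unfolding P(1) friendly_partition_def by simp_all
  ultimately show ?R
    using P(1) by (intro exI[of _ A] exI[of _ B] conjI)
next
  assume ?R
  then obtain A B where AB: "P = {A, B}" "A \<noteq> {}" "B \<noteq> {}" "A \<inter> B = {}" "A \<union> B = verts G"
    "\<forall>x\<in>A. \<exists>y\<in>A. x \<rightarrow>\<^bsub>G\<^esub> y" "\<forall>x\<in>B. \<exists>y\<in>B. x \<rightarrow>\<^bsub>G\<^esub> y"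
    by blast
  then have "A \<noteq> B" by auto
  with AB show ?L
    unfolding friendly_partition_def partition_on_def disjoint_def
    by (simp add: Int_commute)
qed

lemma (in nomulti_digraph) out_degree_eq_card_dominated:
  "out_degree G x = card {y. x \<rightarrow>\<^bsub>G\<^esub> y}"
proof -
  have "inj_on (head G) (out_arcs G x)"
    by (auto intro!: inj_onI no_multi_arcs simp: arc_to_ends_def)
  moreover have "head G ` out_arcs G x = {y. x \<rightarrow>\<^bsub>G\<^esub> y}"
    by (auto simp: arcs_ends_conv image_iff)
  ultimately show ?thesis
    unfolding out_degree_def by (metis card_image)
qed

text \<open>The map \<open>g\<close> is meant to enumerate the vertices of \<open>G\<close> on \<open>{..<m}\<close> and to be constantly \<open>v\<close>
  from \<open>m\<close> on, so that the indices from \<open>m\<close> on are the added clones of \<open>v\<close>.\<close>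

definition clone_digraph ::
  "('a, 'b) pre_digraph \<Rightarrow> 'a \<Rightarrow> (nat \<Rightarrow> 'a) \<Rightarrow> nat \<Rightarrow> nat \<Rightarrow> (nat, nat \<times> nat) pre_digraph" where
  "clone_digraph G v g m n =
     \<lparr>verts = {..<n}, arcs = {(i, j). i < n \<and> j < m \<and> g j \<noteq> v \<and> g i \<rightarrow>\<^bsub>G\<^esub> g j},
      tail = fst, head = snd\<rparr>"

lemma verts_clone_digraph [simp]: "verts (clone_digraph G v g m n) = {..<n}"
  by (simp add: clone_digraph_def)

lemma dominates_clone_digraph_iff [simp]:
  "i \<rightarrow>\<^bsub>clone_digraph G v g m n\<^esub> j \<longleftrightarrow> i < n \<and> j < m \<and> g j \<noteq> v \<and> g i \<rightarrow>\<^bsub>G\<^esub> g j"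
  by (auto simp: clone_digraph_def arcs_ends_def arc_to_ends_def image_iff)

locale vertex_cloning = digraph G for G :: "('a, 'b) pre_digraph" +
  fixes v :: 'a and g :: "nat \<Rightarrow> 'a" and m n :: nat
  assumes v: "v \<in> verts G"
    and enum: "bij_betw g {..<m} (verts G)"
    and clone: "m \<le> i \<Longrightarrow> g i = v"
    and size: "m \<le> n"
begin

abbreviation "H \<equiv> clone_digraph G v g m n"

lemma digraph_clone_digraph: "digraph H"
proof
  have "arcs H \<subseteq> {..<n} \<times> {..<m}"
    by (auto simp: clone_digraph_def)
  then show "finite (arcs H)"
    by (rule finite_subset) simp
qed (use size in \<open>auto simp: clone_digraph_def arc_to_ends_def dest: adj_not_same\<close>)

lemma g_in_verts: "g i \<in> verts G"
  using enum v clone by (cases "i < m") (auto simp: bij_betw_def)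

text \<open>\<open>g\<close> maps the out-neighbours of \<open>i\<close> in \<open>H\<close>
  injectively onto the out-neighbours of \<open>g i\<close> in \<open>G\<close> other than
  \<open>v\<close>, so at most one is lost.\<close>

lemma out_degree_clone_digraph:
  assumes "i < n"
  shows "out_degree G (g i) \<le> out_degree H i + 1"
proof -
  interpret H: digraph H by (rule digraph_clone_digraph)
  have img: "g ` {j. i \<rightarrow>\<^bsub>H\<^esub> j} = {y. g i \<rightarrow>\<^bsub>G\<^esub> y} - {v}"
  proof (intro set_eqI iffI)
    fix y assume y: "y \<in> {y. g i \<rightarrow>\<^bsub>G\<^esub> y} - {v}"
    then have "y \<in> g ` {..<m}" using enum by (auto simp: bij_betw_def)
    with y assms show "y \<in> g ` {j. i \<rightarrow>\<^bsub>H\<^esub> j}" by auto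
  qed auto
  have "inj_on g {j. i \<rightarrow>\<^bsub>H\<^esub> j}"
    using enum by (auto simp: bij_betw_def inj_on_def)
  then have "out_degree H i = card ({y. g i \<rightarrow>\<^bsub>G\<^esub> y} - {v})"
    by (metis H.out_degree_eq_card_dominated card_image img)
  then show ?thesis
    by (auto simp: out_degree_eq_card_dominated card_Diff_singleton_if)
qed

lemma min_out_degree_clone_digraph: "min_out_degree G \<le> min_out_degree H + 1"
proof -
  \<comment> \<open>\<open>Min\<close> is attained only on a nonempty set; the vertex
    \<open>v\<close> guarantees that \<open>H\<close> has a vertex.\<close>
  have "m \<noteq> 0" using enum v by (auto simp: bij_betw_def)
  then have "out_degree H ` verts H \<noteq> {}" using size by (simp add: lessThan_empty_iff)
  then obtain i where i: "i < n" "min_out_degree H = out_degree H i"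
    unfolding min_out_degree_def
    using Min_in[of "out_degree H ` verts H"] by (auto simp del: Min_in)
  have "min_out_degree G \<le> out_degree G (g i)"
    unfolding min_out_degree_def using g_in_verts by simp
  with out_degree_clone_digraph[OF i(1)] i(2) show ?thesis by simp
qed

text \<open>No arc of \<open>H\<close> enters \<open>v\<close> or a clone. Hence every friendly
  witness is an original vertex other than \<open>v\<close> and survives when \<open>v\<close> is
  moved to the side of \<open>i\<close>.\<close>

lemma friendly_partition_merge_clones:
  assumes AB: "A \<inter> B = {}" "A \<union> B = {..<n}"
    and A: "\<forall>x\<in>A. \<exists>y\<in>A. x \<rightarrow>\<^bsub>H\<^esub> y" and B: "\<forall>x\<in>B. \<exists>y\<in>B. x \<rightarrow>\<^bsub>H\<^esub> y"
    and i: "i \<in> B" "g i = v"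
    and j: "j \<in> A" "j < m" "g j \<noteq> v"
  shows "\<exists>P. friendly_partition G P \<and> separates P (g j) v"
proof -
  \<comment> \<open>The original index of \<open>v\<close> may lie in \<open>A\<close>, so
    \<open>v\<close> has to be removed here; \<open>g j\<close> keeps \<open>A'\<close>
    nonempty.\<close>
  define A' where "A' = g ` (A \<inter> {..<m}) - {v}"
  define B' where "B' = insert v (g ` (B \<inter> {..<m}))"
  have inj: "inj_on g {..<m}" and V: "g ` {..<m} = verts G"
    using enum by (auto simp: bij_betw_def)
  have disj: "A' \<inter> B' = {}"
    using AB(1) inj by (fastforce simp: A'_def B'_def inj_on_def)
  have "A \<inter> {..<m} \<union> B \<inter> {..<m} = {..<m}"
    using size by (simp add: AB(2) Int_absorb1 flip: Int_Un_distrib2)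
  then have "g ` (A \<inter> {..<m}) \<union> g ` (B \<inter> {..<m}) = verts G"
    by (metis V image_Un)
  then have un: "A' \<union> B' = verts G"
    using v unfolding A'_def B'_def by blast
  have fA: "\<exists>y\<in>A'. x \<rightarrow>\<^bsub>G\<^esub> y" if "x \<in> A'" for x
    using that A by (fastforce simp: A'_def)
  have fB: "\<exists>y\<in>B'. x \<rightarrow>\<^bsub>G\<^esub> y" if "x \<in> B'" for x
  proof -
    \<comment> \<open>For \<open>x = v\<close> the representative in \<open>B\<close> is
      \<open>i\<close>, possibly a clone: it has the out-neighbours of \<open>v\<close> except for
      deleted arcs.\<close>
    from that obtain k where k: "k \<in> B" "x = g k"
    proof (cases "x = v")
      case True
      with i that show thesis by metis
    qed (auto simp: B'_def)
    then obtain l where "l \<in> B" "l < m" "g k \<rightarrow>\<^bsub>G\<^esub> g l" using B by auto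
    with k show ?thesis unfolding B'_def by blast
  qed
  have mem: "g j \<in> A'" "v \<in> B'" using j by (auto simp: A'_def B'_def)
  have "friendly_partition G {A', B'}"
    unfolding friendly_partition_iff using disj un fA fB mem
    by (intro exI[of _ A'] exI[of _ B'] conjI refl ballI) auto
  moreover have "separates {A', B'} (g j) v"
    using mem disj by (auto simp: separates_def)
  ultimately show ?thesis by blast
qed

text \<open>The part avoiding the index \<open>j\<close> of \<open>u\<close> contains no index
  mapped to \<open>v\<close>, hence no clone. It is a subset of \<open>{..<m}\<close> and determines
  the partition.\<close>

lemma card_friendly_partitions_clone_digraph:
  assumes u: "u \<in> verts G" "u \<noteq> v"
    and insep: "\<nexists>P. friendly_partition G P \<and> separates P u v"
  shows "card {P. friendly_partition H P} \<le> 2 ^ m"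
proof -
  obtain j where j: "j < m" "g j = u"
    using enum u(1) by (force simp: bij_betw_def)
  have other: "B \<subseteq> {..<m}"
    if "A \<inter> B = {}" "A \<union> B = {..<n}" "j \<in> A"
      "\<forall>x\<in>A. \<exists>y\<in>A. x \<rightarrow>\<^bsub>H\<^esub> y" "\<forall>x\<in>B. \<exists>y\<in>B. x \<rightarrow>\<^bsub>H\<^esub> y" for A B
  proof
    fix i assume "i \<in> B"
    with friendly_partition_merge_clones[OF that(1,2,4,5) _ _ that(3)] j u(2) insep
    have "g i \<noteq> v" by blast
    then show "i \<in> {..<m}" using clone[of i] by (cases "i < m") auto
  qed
  have "{P. friendly_partition H P} \<subseteq> (\<lambda>B. {{..<n} - B, B}) ` Pow {..<m}"
  proof clarify
    fix P assume "friendly_partition H P"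
    then obtain A B where P: "P = {A, B}" and AB: "A \<inter> B = {}" "A \<union> B = {..<n}"
      "\<forall>x\<in>A. \<exists>y\<in>A. x \<rightarrow>\<^bsub>H\<^esub> y" "\<forall>x\<in>B. \<exists>y\<in>B. x \<rightarrow>\<^bsub>H\<^esub> y"
      unfolding friendly_partition_iff verts_clone_digraph by blast
    have "j \<in> A \<union> B" using AB(2) j(1) size by auto
    then consider "j \<in> A" | "j \<in> B" by blast
    then show "P \<in> (\<lambda>B. {{..<n} - B, B}) ` Pow {..<m}"
    proof cases
      case 1
      have "A = {..<n} - B" using AB(1,2) by blast
      then show ?thesis using other[OF AB(1,2) 1 AB(3,4)] P by blast
    next
      case 2
      have "B = {..<n} - A" using AB(1,2) by blast
      then show ?thesis
        using other[of B A] 2 AB P by (simp add: Int_commute Un_commute insert_commute)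
    qed
  qed
  then have "card {P. friendly_partition H P} \<le> card (Pow {..<m})"
    by (intro surj_card_le) auto
  then show ?thesis by (simp add: card_Pow)
qed

end

lemma min_friendly_partitions_le:
  fixes G :: "(nat, nat \<times> nat) pre_digraph"
  assumes "digraph G" "d \<le> min_out_degree G"
  shows "min_friendly_partitions d (card (verts G)) \<le> card {P. friendly_partition G P}"
  unfolding min_friendly_partitions_def using assms by (intro cINF_lower) auto

lemma (in digraph) min_friendly_partitions_bounded_if_inseparable:
  assumes deg: "d + 1 \<le> min_out_degree G"
    and uv: "u \<in> verts G" "v \<in> verts G" "u \<noteq> v"
    and insep: "\<nexists>P. friendly_partition G P \<and> separates P u v"
    and n: "card (verts G) \<le> n"
  shows "min_friendly_partitions d n \<le> 2 ^ card (verts G)"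
proof -
  obtain f where f: "bij_betw f {..<card (verts G)} (verts G)"
    using ex_bij_betw_nat_finite[OF finite_verts] by (auto simp: lessThan_atLeast0)
  define g where "g i = (if i < card (verts G) then f i else v)" for i
  have "bij_betw g {..<card (verts G)} (verts G)"
    using f by (subst bij_betw_cong[where g = f]) (simp_all add: g_def)
  then interpret vertex_cloning G v g "card (verts G)" n
    using uv n by unfold_locales (auto simp: g_def)
  have "min_friendly_partitions d n \<le> card {P. friendly_partition H P}"
    using min_friendly_partitions_le[OF digraph_clone_digraph, of d]
      min_out_degree_clone_digraph deg by simp
  also have "\<dots> \<le> 2 ^ card (verts G)"
    using uv insep by (intro card_friendly_partitions_clone_digraph) auto
  finally show ?thesis .
qed

theorem theorem1p9:
  fixes d :: nat
  assumes "\<not> bdd_above (min_friendly_partitions d ` {n. d < n})"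
  shows "\<forall>G :: ('a, 'b) pre_digraph. digraph G \<and> d + 1 \<le> min_out_degree G \<longrightarrow>
    (\<forall>u \<in> verts G. \<forall>v \<in> verts G. u \<noteq> v \<longrightarrow>
      (\<exists>P. friendly_partition G P \<and> separates P u v))"
proof (rule ccontr)
  assume "\<not> ?thesis"
  then obtain G :: "('a, 'b) pre_digraph" and u v where G: "digraph G" "d + 1 \<le> min_out_degree G"
    "u \<in> verts G" "v \<in> verts G" "u \<noteq> v" "\<nexists>P. friendly_partition G P \<and> separates P u v"
    by blast
  let ?m = "card (verts G)" and ?t = "min_friendly_partitions d"
  \<comment> \<open>Cloning only adds vertices, so the bound starts at \<open>n = ?m\<close>; the
    finitely many smaller \<open>n\<close> contribute finitely many values.\<close>
  have "?t n \<in> ?t ` {..<?m} \<union> {..2 ^ ?m}" for n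
    using digraph.min_friendly_partitions_bounded_if_inseparable[OF G, of n]
    by (cases "n < ?m") auto
  then have "range ?t \<subseteq> ?t ` {..<?m} \<union> {..2 ^ ?m}"
    by blast
  then have "finite (range ?t)"
    by (rule finite_subset) simp
  then have "bdd_above (?t ` {n. d < n})"
    by (intro bdd_above_finite) (auto intro: finite_subset)
  with assms show False ..
qed

end
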